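(* For every real $x\neq 0$, $$\sum_{k=0}^{\infty}\frac{x^k}{k!}\,c_k=\frac{e^x}{x}R(x).$$
   Context: Let $\zeta$ denote the Riemann zeta function. For real $x$ define the Riesz function $$R(x) = x\sum_{k=0}^{\infty}\frac{(-1)^k x^k}{k!\,\zeta(2k+2)},$$ and for integers $k\ge 0$ define the Báez-Duarte sequence $$c_k=\sum_{j=0}^{k}(-1)^j\binom{k}{j}\frac{1}{\zeta(2j+2)}.$$ *)

theory Defs
  imports "HOL-Complex_Analysis.Complex_Analysis"
begin

definition zeta_series :: "complex \<Rightarrow> complex" where
  "zeta_series s = (\<Sum>n. 1 / of_nat (Suc n) powr s)"

text \<open>Off the half-plane of convergence, zeta is the analytic continuation of the series to the
  complex plane punctured at 1, which is unique on that domain. The value at the pole is set to 0.\<close>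

definition zeta :: "complex \<Rightarrow> complex" where
  "zeta s = (if Re s > 1 then zeta_series s
             else if s = 1 then 0
             else (SOME f. f holomorphic_on (- {1}) \<and> (\<forall>z. Re z > 1 \<longrightarrow> f z = zeta_series z)) s)"

definition riesz :: "real \<Rightarrow> complex" where
  "riesz x = of_real x *
     (\<Sum>k. (- 1) ^ k * of_real x ^ k / (fact k * zeta (of_nat (2 * k + 2))))"

definition baez_duarte :: "nat \<Rightarrow> complex" where
  "baez_duarte k = (\<Sum>j\<le>k. (- 1) ^ j * of_nat (k choose j) * (1 / zeta (of_nat (2 * j + 2))))"

end

theory Submission
  imports Defs
begin

text \<open>Since \<open>x\<^sup>k / k! * (k choose j) = (x\<^sup>j / j!) * (x\<^sup>k\<^sup>-\<^sup>j / (k - j)!)\<close>, the series on the left is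
  the Cauchy product of the exponential series with the power series that defines \<^term>\<open>riesz x\<close>
  up to the factor \<open>x\<close>. It remains to see that both factors converge absolutely. For the second this
  follows by comparison with the exponential series of \<open>\<bar>x\<bar>\<close>: at integers \<open>m \<ge> 2\<close> the
  Dirichlet series of zeta has positive terms, the first of which is 1, so \<open>\<bar>1 / \<zeta>(m)\<bar> \<le> 1\<close>
  (lemma \<open>norm_zeta_of_nat_ge_1\<close>).\<close>

lemma summable_zeta_of_nat:
  assumes "m \<ge> 2"
  shows "summable (\<lambda>n. 1 / real (Suc n) ^ m)"
  using inverse_power_summable[OF assms, where ?'a = real]
  by (subst (asm) summable_Suc_iff [symmetric]) (simp add: inverse_eq_divide)

lemma zeta_of_nat:
  assumes "m \<ge> 2"
  shows "zeta (of_nat m) = of_real (\<Sum>n. 1 / real (Suc n) ^ m)"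
proof -
  have "zeta (of_nat m) = (\<Sum>n. 1 / of_nat (Suc n) powr of_nat m)"
    using assms by (simp add: zeta_def zeta_series_def)
  also have "\<dots> = (\<Sum>n. complex_of_real (1 / real (Suc n) ^ m))"
    using assms by (intro suminf_cong) (simp add: powr_nat' del: of_nat_Suc)
  also have "\<dots> = of_real (\<Sum>n. 1 / real (Suc n) ^ m)"
    by (rule suminf_of_real[OF summable_zeta_of_nat[OF assms], symmetric])
  finally show ?thesis .
qed

lemma norm_zeta_of_nat_ge_1:
  assumes "m \<ge> 2"
  shows "norm (zeta (of_nat m)) \<ge> 1"
proof -
  have "(\<Sum>n<1. 1 / real (Suc n) ^ m) \<le> (\<Sum>n. 1 / real (Suc n) ^ m)"
    by (intro sum_le_suminf summable_zeta_of_nat assms) auto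
  then have "1 \<le> (\<Sum>n. 1 / real (Suc n) ^ m)"
    by simp
  then show ?thesis
    unfolding zeta_of_nat[OF assms] norm_of_real by linarith
qed

lemma summable_norm_riesz_series:
  fixes x :: real
  shows "summable (\<lambda>k. norm ((- 1) ^ k * of_real x ^ k / (fact k * zeta (of_nat (2 * k + 2)))))"
proof (rule summable_comparison_test')
  show "summable (\<lambda>k. inverse (fact k) * \<bar>x\<bar> ^ k)"
    by (rule summable_exp)
next
  fix k :: nat
  have ge1: "norm (zeta (of_nat (2 * k + 2))) \<ge> 1"
    by (rule norm_zeta_of_nat_ge_1) simp
  have "norm ((- 1) ^ k * of_real x ^ k / (fact k * zeta (of_nat (2 * k + 2)))) =
          \<bar>x\<bar> ^ k / (fact k * norm (zeta (of_nat (2 * k + 2))))"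
    by (simp add: norm_mult norm_divide norm_power del: of_nat_add of_nat_mult)
  also have "\<dots> \<le> \<bar>x\<bar> ^ k / (fact k * 1)"
    using ge1 by (intro divide_left_mono mult_left_mono mult_pos_pos) auto
  finally show "norm (norm ((- 1) ^ k * of_real x ^ k / (fact k * zeta (of_nat (2 * k + 2)))))
                  \<le> inverse (fact k) * \<bar>x\<bar> ^ k"
    by (simp add: field_simps del: of_nat_add of_nat_mult)
qed

theorem mainTheorem2:
  fixes x :: real
  assumes "x \<noteq> 0"
  shows "(\<lambda>k. of_real x ^ k / fact k * baez_duarte k) sums
           (of_real (exp x) / of_real x * riesz x)"
proof -
  define a :: "nat \<Rightarrow> complex"
    where "a = (\<lambda>k. (- 1) ^ k * of_real x ^ k / (fact k * zeta (of_nat (2 * k + 2))))"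
  define b :: "nat \<Rightarrow> complex" where "b = (\<lambda>k. of_real x ^ k /\<^sub>R fact k)"
  have "summable (\<lambda>k. norm (a k))"
    unfolding a_def by (rule summable_norm_riesz_series)
  moreover have "summable (\<lambda>k. norm (b k))"
    unfolding b_def by (rule summable_norm_exp)
  ultimately have "(\<lambda>k. \<Sum>j\<le>k. a j * b (k - j)) sums ((\<Sum>k. a k) * (\<Sum>k. b k))"
    by (rule Cauchy_product_sums)
  moreover have "(\<Sum>j\<le>k. a j * b (k - j)) = of_real x ^ k / fact k * baez_duarte k" for k
    unfolding baez_duarte_def sum_distrib_left
  proof (rule sum.cong)
    fix j assume "j \<in> {..k}"
    then have j: "j \<le> k" by simp
    have "complex_of_real x ^ k = of_real x ^ j * of_real x ^ (k - j)"
      using j by (simp flip: power_add)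
    then show "a j * b (k - j) = of_real x ^ k / fact k *
        ((- 1) ^ j * of_nat (k choose j) * (1 / zeta (of_nat (2 * j + 2))))"
      by (simp add: a_def b_def binomial_fact[OF j] scaleR_conv_of_real inverse_eq_divide mult_ac
               del: of_nat_add of_nat_mult)
  qed simp
  moreover have "(\<Sum>k. b k) = of_real (exp x)"
    unfolding b_def exp_of_real[symmetric] by (simp add: exp_def)
  moreover have "of_real (exp x) / of_real x * riesz x = (\<Sum>k. a k) * of_real (exp x)"
    using assms by (simp add: riesz_def a_def)
  ultimately show ?thesis by simp
qed

end
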